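(* Assume that for every nonempty set $A\subseteq\mathcal X\setminus\mathcal O$ there exists $x\in A$ such that $|\mathcal N_x\cap A|\le1$, and assume $\mathcal O\ne\emptyset$. Let $g\colon\mathcal O\to\mathbb R$ and $$\mathcal S_H=\bigl\{v\colon\mathcal X\to\mathbb R\ :\ v(x)\le H_1[v](x)\ \text{for } x\in\mathcal X\setminus\mathcal O,\ \ v(x)=g(x)\ \text{for } x\in\mathcal O\bigr\}.$$ Then the function $u\colon\mathcal X\to\mathbb R$ defined by $$u(x)=\sup_{v\in\mathcal S_H}v(x)$$ is the unique solution of $$\begin{cases}u(x)=H_1[u](x),&x\in\mathcal X\setminus\mathcal O,\\ u(x)=g(x),&x\in\mathcal O.\end{cases}$$
   Context: $\mathcal G=(\mathcal X,E)$ is a finite simple undirected graph, $\mathcal O\subseteq\mathcal X$ is the set of boundary vertices, and $\mathcal N_x$ is the set of neighbors of $x$. There is a fixed even integer $n\ge2$ with $|\mathcal N_x|=n$ for every $x\in\mathcal X\setminus\mathcal O$ (no degree condition on vertices of $\mathcal O$). For $u\colon\mathcal X\to\mathbb R$ and $x\in\mathcal X\setminus\mathcal O$, $$H_1[u](x)=\min_{\substack{y,z\in\mathcal N_x\\ y\ne z}}\frac{u(y)+u(z)}2.$$ *)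

theory Defs
  imports Complex_Main "HOL-Library.FuncSet" "Graph_Theory.Pair_Digraph"
begin

text \<open>
  A finite simple undirected graph is a \<^locale>\<open>pair_graph\<close>: finite vertex set, and as arc set a
  finite, irreflexive, symmetric relation on the vertices.
\<close>

definition neighbours :: "'a pair_pre_digraph \<Rightarrow> 'a \<Rightarrow> 'a set" where
  "neighbours G x = {y. (x, y) \<in> parcs G}"

text \<open>
  Only meaningful when \<open>x\<close> has at least two (and finitely many) neighbours: \<^const>\<open>Min\<close> of the empty
  set is unspecified.
\<close>

definition H1 :: "'a pair_pre_digraph \<Rightarrow> ('a \<Rightarrow> real) \<Rightarrow> 'a \<Rightarrow> real" where
  "H1 G u x = Min {(u y + u z) / 2 | y z. y \<in> neighbours G x \<and> z \<in> neighbours G x \<and> y \<noteq> z}"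

text \<open>
  Real functions on the vertex set are elements of \<open>pverts G \<rightarrow>\<^sub>E UNIV\<close>, i.e. they take the
  fixed value \<^const>\<open>undefined\<close> off the vertex set, so that equality in HOL is equality on the vertices.
\<close>

definition subsolutions :: "'a pair_pre_digraph \<Rightarrow> 'a set \<Rightarrow> ('a \<Rightarrow> real) \<Rightarrow> ('a \<Rightarrow> real) set" where
  "subsolutions G B g =
    {v \<in> pverts G \<rightarrow>\<^sub>E UNIV. (\<forall>x \<in> pverts G - B. v x \<le> H1 G v x) \<and> (\<forall>x \<in> B. v x = g x)}"

definition is_solution :: "'a pair_pre_digraph \<Rightarrow> 'a set \<Rightarrow> ('a \<Rightarrow> real) \<Rightarrow> ('a \<Rightarrow> real) \<Rightarrow> bool" where
  "is_solution G B g u \<longleftrightarrow> u \<in> pverts G \<rightarrow>\<^sub>E UNIV \<and>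
    (\<forall>x \<in> pverts G - B. u x = H1 G u x) \<and> (\<forall>x \<in> B. u x = g x)"

definition sup_subsolutions :: "'a pair_pre_digraph \<Rightarrow> 'a set \<Rightarrow> ('a \<Rightarrow> real) \<Rightarrow> 'a \<Rightarrow> real" where
  "sup_subsolutions G B g = (\<lambda>x \<in> pverts G. SUP v \<in> subsolutions G B g. v x)"

end

theory Submission
  imports Defs
begin

text \<open>
  Comparison principle: if a subsolution exceeds a supersolution somewhere in the interior, let \<open>A\<close>
  be the set where the difference is maximal, and let \<open>x \<in> A\<close> have at most one neighbour in \<open>A\<close>. At
  \<open>x\<close> the difference is at most its average over the two neighbours that realise the minimum for the
  supersolution; one of them is outside \<open>A\<close>, so this average is below the maximum.
  Comparison with the constant \<open>max g\<close> bounds the subsolutions, Perron's method shows that their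
  supremum is a solution, and comparing two solutions gives uniqueness.
\<close>

locale h1_dirichlet = pair_graph G for G :: "'a pair_pre_digraph" +
  fixes B :: "'a set" and g :: "'a \<Rightarrow> real"
  assumes boundary_subset: "B \<subseteq> pverts G"
    and two_neighbours: "x \<in> pverts G - B \<Longrightarrow> 2 \<le> card (neighbours G x)"
    and sparse_vertex:
      "A \<subseteq> pverts G - B \<Longrightarrow> A \<noteq> {} \<Longrightarrow> \<exists>x \<in> A. card (neighbours G x \<inter> A) \<le> 1"
begin

lemma finite_boundary: "finite B"
  using boundary_subset pair_finite_verts finite_subset by blast

lemma neighbours_subset: "neighbours G x \<subseteq> pverts G"
  unfolding neighbours_def using in_arcsD2 by auto

lemma finite_neighbours: "finite (neighbours G x)"
  using neighbours_subset pair_finite_verts finite_subset by blast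

lemma finite_averages:
  fixes u :: "'a \<Rightarrow> real"
  shows "finite {(u y + u z) / 2 | y z. y \<in> neighbours G x \<and> z \<in> neighbours G x \<and> y \<noteq> z}"
proof (rule finite_subset)
  show "{(u y + u z) / 2 | y z. y \<in> neighbours G x \<and> z \<in> neighbours G x \<and> y \<noteq> z}
    \<subseteq> {(u y + u z) / 2 | y z. y \<in> neighbours G x \<and> z \<in> neighbours G x}"
    by blast
qed (intro finite_image_set2, simp_all add: finite_neighbours)

lemma averages_nonempty:
  fixes u :: "'a \<Rightarrow> real"
  assumes "x \<in> pverts G - B"
  shows "{(u y + u z) / 2 | y z. y \<in> neighbours G x \<and> z \<in> neighbours G x \<and> y \<noteq> z} \<noteq> {}"
proof -
  have "\<not> card (neighbours G x) \<le> Suc 0"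
    using two_neighbours[OF assms] by simp
  then obtain y z where "y \<in> neighbours G x" "z \<in> neighbours G x" "y \<noteq> z"
    using card_le_Suc0_iff_eq[OF finite_neighbours] by blast
  then show ?thesis by blast
qed

text \<open>Together with \<open>H1_attained\<close> this replaces \<open>Min\<close>: any pair of
  distinct neighbours bounds \<open>H1\<close> from above, and some pair realises it.\<close>

lemma le_H1_iff:
  assumes "x \<in> pverts G - B"
  shows "c \<le> H1 G u x \<longleftrightarrow>
    (\<forall>y \<in> neighbours G x. \<forall>z \<in> neighbours G x. y \<noteq> z \<longrightarrow> c \<le> (u y + u z) / 2)"
  unfolding H1_def Min_ge_iff[OF finite_averages averages_nonempty[OF assms]] by blast

lemma H1_attained:
  assumes "x \<in> pverts G - B"
  obtains y z where "y \<in> neighbours G x" "z \<in> neighbours G x" "y \<noteq> z" "H1 G u x = (u y + u z) / 2"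
  using Min_in[OF finite_averages averages_nonempty[OF assms], of u] that
  unfolding H1_def by blast

text \<open>Constants thus solve the interior equation and serve as barriers from below and
  above.\<close>

lemma H1_const:
  assumes "x \<in> pverts G - B"
  shows "H1 G (\<lambda>_. c) x = c"
  using H1_attained[OF assms, of "\<lambda>_. c"] by auto

text \<open>The pair that realises the minimum for \<open>v\<close> is a competitor in the minimum
  for \<open>u\<close>.\<close>

lemma H1_mono:
  assumes "x \<in> pverts G - B" and "\<And>y. y \<in> pverts G \<Longrightarrow> u y \<le> v y"
  shows "H1 G u x \<le> H1 G v x"
proof -
  obtain y z where yz: "y \<in> neighbours G x" "z \<in> neighbours G x" "y \<noteq> z"
    "H1 G v x = (v y + v z) / 2"
    using H1_attained[OF assms(1)] by metis
  then have "H1 G u x \<le> (u y + u z) / 2"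
    using le_H1_iff[OF assms(1)] by blast
  then show ?thesis
    using assms(2)[of y] assms(2)[of z] yz neighbours_subset by fastforce
qed

lemma comparison:
  assumes sub: "\<And>x. x \<in> pverts G - B \<Longrightarrow> v x \<le> H1 G v x"
    and super: "\<And>x. x \<in> pverts G - B \<Longrightarrow> H1 G w x \<le> w x"
    and boundary: "\<And>x. x \<in> B \<Longrightarrow> v x \<le> w x"
    and "x \<in> pverts G"
  shows "v x \<le> w x"
proof (rule ccontr)
  assume "\<not> v x \<le> w x"
  define d where "d y = v y - w y" for y
  define M where "M = Max (d ` pverts G)"
  have le_M: "d y \<le> M" if "y \<in> pverts G" for y
    unfolding M_def using that pair_finite_verts by simp
  have "M > 0"
    using le_M[OF \<open>x \<in> pverts G\<close>] \<open>\<not> v x \<le> w x\<close> unfolding d_def by linarith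
  define A where "A = {y \<in> pverts G. d y = M}"
  have "M \<in> d ` pverts G"
    unfolding M_def using pair_finite_verts \<open>x \<in> pverts G\<close> by (intro Max_in) auto
  then have "A \<noteq> {}"
    unfolding A_def by auto
  \<comment> \<open>On \<open>B\<close> the difference is at most 0, hence below
    \<open>M\<close>.\<close>
  moreover have "A \<subseteq> pverts G - B"
    using boundary \<open>M > 0\<close> unfolding A_def d_def by force
  ultimately obtain a where a: "a \<in> A" "card (neighbours G a \<inter> A) \<le> 1" and "a \<in> pverts G - B"
    using sparse_vertex by blast
  obtain y z where yz: "y \<in> neighbours G a" "z \<in> neighbours G a" "y \<noteq> z"
    "H1 G w a = (w y + w z) / 2"
    using H1_attained[OF \<open>a \<in> pverts G - B\<close>] by metis
  \<comment> \<open>The pair is minimal for \<open>w\<close> but only a competitor for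
    \<open>v\<close>; this is the direction needed to subtract the two inequalities at
    \<open>a\<close>.\<close>
  have "v a \<le> (v y + v z) / 2"
    using sub[OF \<open>a \<in> pverts G - B\<close>] le_H1_iff[OF \<open>a \<in> pverts G - B\<close>] yz by blast
  then have "M \<le> (d y + d z) / 2"
    using super[OF \<open>a \<in> pverts G - B\<close>] yz(4) a(1) unfolding A_def d_def by simp
  moreover have "y \<in> pverts G" "z \<in> pverts G"
    using yz neighbours_subset by auto
  \<comment> \<open>Two numbers bounded by \<open>M\<close> whose average is at least
    \<open>M\<close> both equal \<open>M\<close>.\<close>
  ultimately have "y \<in> A" "z \<in> A"
    using le_M[of y] le_M[of z] unfolding A_def by auto
  moreover have "finite (neighbours G a \<inter> A)"
    using finite_neighbours by simp
  ultimately show False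
    using a(2) yz card_le_Suc0_iff_eq[of "neighbours G a \<inter> A"] by auto
qed

text \<open>The witness extends \<open>g\<close> inwards by its minimum. It dominates that constant
  everywhere and equals it at interior vertices, so monotonicity of \<open>H1\<close> gives the
  inequality.\<close>

lemma subsolutions_nonempty: "subsolutions G B g \<noteq> {}"
proof -
  define v where "v = (\<lambda>x \<in> pverts G. if x \<in> B then g x else Min (g ` B))"
  have min_le: "Min (g ` B) \<le> v y" if "y \<in> pverts G" for y
    using that finite_boundary unfolding v_def by auto
  have "v x \<le> H1 G v x" if "x \<in> pverts G - B" for x
  proof -
    have "v x = H1 G (\<lambda>_. Min (g ` B)) x"
      using that by (simp add: H1_const v_def)
    also have "\<dots> \<le> H1 G v x"
      using that min_le by (rule H1_mono)
    finally show ?thesis .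
  qed
  then have "v \<in> subsolutions G B g"
    using boundary_subset unfolding subsolutions_def v_def by auto
  then show ?thesis by blast
qed

lemma subsolution_le_Max:
  assumes "v \<in> subsolutions G B g" and "x \<in> pverts G"
  shows "v x \<le> Max (g ` B)"
  \<comment> \<open>The constant is a supersolution by \<open>H1_const\<close> and dominates
    \<open>g\<close> on the boundary.\<close>
  by (rule comparison[of v "\<lambda>_. Max (g ` B)"])
    (use assms finite_boundary in \<open>auto simp: subsolutions_def H1_const\<close>)

lemma bdd_above_subsolutions:
  assumes "x \<in> pverts G"
  shows "bdd_above ((\<lambda>v. v x) ` subsolutions G B g)"
  using subsolution_le_Max assms by (intro bdd_aboveI2) auto

lemma subsolution_le_sup:
  assumes "v \<in> subsolutions G B g" and "x \<in> pverts G"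
  shows "v x \<le> sup_subsolutions G B g x"
  using assms bdd_above_subsolutions unfolding sup_subsolutions_def by (auto intro: cSUP_upper)

text \<open>By monotonicity, \<open>H1\<close> of the supremum bounds every single subsolution at
  \<open>x\<close>, hence also their supremum.\<close>

lemma sup_subsolution: "sup_subsolutions G B g \<in> subsolutions G B g"
proof -
  let ?u = "sup_subsolutions G B g"
  have "?u x \<le> H1 G ?u x" if x: "x \<in> pverts G - B" for x
  proof -
    have "v x \<le> H1 G ?u x" if "v \<in> subsolutions G B g" for v
    proof -
      have "v x \<le> H1 G v x"
        using that x unfolding subsolutions_def by blast
      also have "\<dots> \<le> H1 G ?u x"
        using x subsolution_le_sup[OF that] by (rule H1_mono)
      finally show ?thesis .
    qed
    then have "(SUP v \<in> subsolutions G B g. v x) \<le> H1 G ?u x"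
      using subsolutions_nonempty by (intro cSUP_least)
    then show ?thesis
      using x by (simp add: sup_subsolutions_def)
  qed
  moreover have "?u x = g x" if "x \<in> B" for x
  proof -
    \<comment> \<open>All subsolutions agree at a boundary vertex, so the supremum there is over a
      singleton.\<close>
    have "(\<lambda>v. v x) ` subsolutions G B g = {g x}"
      using subsolutions_nonempty that unfolding subsolutions_def by force
    then show ?thesis
      using that boundary_subset by (auto simp: sup_subsolutions_def)
  qed
  ultimately show ?thesis
    unfolding subsolutions_def by (auto simp: sup_subsolutions_def)
qed

lemma sup_subsolutions_solution: "is_solution G B g (sup_subsolutions G B g)"
proof -
  let ?u = "sup_subsolutions G B g"
  have sub: "?u x \<le> H1 G ?u x" if "x \<in> pverts G - B" for x
    using sup_subsolution that unfolding subsolutions_def by blast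
  have "H1 G ?u x \<le> ?u x" if x: "x \<in> pverts G - B" for x
  proof -
    \<comment> \<open>Perron lifting: raising the value at the one interior vertex \<open>x\<close>
      yields another subsolution, so maximality of the supremum forces
      \<open>H1 G ?u x \<le> ?u x\<close>.\<close>
    define v where "v = ?u(x := H1 G ?u x)"
    have u_le_v: "?u y \<le> v y" for y
      using sub[OF x] unfolding v_def by simp
    have "v y \<le> H1 G v y" if y: "y \<in> pverts G - B" for y
    proof -
      \<comment> \<open>For \<open>y = x\<close> this is equality by construction; elsewhere
        \<open>v\<close> agrees with the supremum, itself a subsolution.\<close>
      have "v y \<le> H1 G ?u y"
        using sub[OF y] unfolding v_def by simp
      also have "\<dots> \<le> H1 G v y"
        using y u_le_v by (rule H1_mono)
      finally show ?thesis .
    qed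
    then have "v \<in> subsolutions G B g"
      using sup_subsolution x unfolding subsolutions_def v_def by (auto simp: PiE_iff extensional_def)
    then show ?thesis
      using subsolution_le_sup[of v x] x unfolding v_def by simp
  qed
  then show ?thesis
    using sup_subsolution sub unfolding subsolutions_def is_solution_def by (auto intro: antisym)
qed

text \<open>A solution is both a subsolution and a supersolution, so \<open>comparison\<close>
  applies in either order.\<close>

lemma solution_le_solution:
  assumes "is_solution G B g v" and "is_solution G B g w" and "x \<in> pverts G"
  shows "v x \<le> w x"
  by (rule comparison[of v w]) (use assms in \<open>auto simp: is_solution_def\<close>)

lemma solution_unique:
  assumes "is_solution G B g v" and "is_solution G B g w"
  shows "v = w"
proof (rule PiE_ext[of _ "pverts G" "\<lambda>_. UNIV"])
  show "v x = w x" if "x \<in> pverts G" for x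
    using that assms solution_le_solution by (intro antisym) auto
qed (use assms in \<open>auto simp: is_solution_def\<close>)

end

text \<open>The first two conjuncts ensure that the real-valued \<open>SUP\<close> is a genuine
  supremum, taken over a nonempty set bounded above.\<close>

theorem theorem5p4:
  fixes G :: "'a pair_pre_digraph" and B :: "'a set" and n :: nat and g :: "'a \<Rightarrow> real"
  assumes "pair_graph G"
    and "B \<subseteq> pverts G"
    and "even n" and "n \<ge> 2"
    and "\<And>x. x \<in> pverts G - B \<Longrightarrow> card (neighbours G x) = n"
    and "\<And>A. A \<subseteq> pverts G - B \<Longrightarrow> A \<noteq> {} \<Longrightarrow> \<exists>x \<in> A. card (neighbours G x \<inter> A) \<le> 1"
    and "B \<noteq> {}"
  shows "subsolutions G B g \<noteq> {} \<and>
    (\<forall>x \<in> pverts G. bdd_above ((\<lambda>v. v x) ` subsolutions G B g)) \<and>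
    is_solution G B g (sup_subsolutions G B g) \<and>
    (\<forall>w. is_solution G B g w \<longrightarrow> w = sup_subsolutions G B g)"
proof -
  interpret pair_graph G by fact
  interpret h1_dirichlet G B g
    \<comment> \<open>The degree equation and \<open>n \<ge> 2\<close> give
      \<open>two_neighbours\<close>.\<close>
    by unfold_locales (use assms in auto)
  show ?thesis
    by (intro conjI ballI allI impI subsolutions_nonempty bdd_above_subsolutions
        sup_subsolutions_solution solution_unique)
qed

end
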